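(* The monoid $\mathcal{L}$ of Left dead ends is pocancellative: for all Left dead ends $G,H,J$, if $G+J\geq H+J$ then $G\geq H$.
   Context: All games are short partizan combinatorial game forms; $G+H$ is the disjunctive sum. Play is misère (a player unable to move wins). Misère outcome classes are ordered $\mathscr L>\mathscr P>\mathscr R$ and $\mathscr L>\mathscr N>\mathscr R$ ($\mathscr P,\mathscr N$ incomparable); $G\geq H$ means that for every game $X$ the misère outcome of $G+X$ is $\geq$ that of $H+X$, and $G=H$ means $G\ge H$ and $H\ge G$. A Left dead end is a game no subposition of which (including itself) has a Left option. The Left dead ends form a commutative monoid $\mathcal{L}$ under $+$ with identity $0=\{\cdot\mid\cdot\}$, partially ordered by $\geq$. *)

theory Defs
  imports Main "HOL-Library.FSet"
begin

datatype game = Game (left_opts: "game fset") (right_opts: "game fset")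

definition is_option :: "game \<Rightarrow> game \<Rightarrow> bool" where
  "is_option H G \<longleftrightarrow> H |\<in>| left_opts G \<or> H |\<in>| right_opts G"

text \<open>Every game counts as a subposition of itself.\<close>

definition subposition :: "game \<Rightarrow> game \<Rightarrow> bool" where
  "subposition = is_option\<^sup>*\<^sup>*"

lemma size_member_le: "H |\<in>| A \<Longrightarrow> size H < (\<Sum>x\<in>fset A. Suc (size x))"
  using member_le_sum[of H "fset A" "\<lambda>x. Suc (size x)"] by simp

lemma size_left_option: "H |\<in>| left_opts G \<Longrightarrow> size H < size G"
  using size_member_le[of H "left_opts G"] by (cases G) simp

lemma size_right_option: "H |\<in>| right_opts G \<Longrightarrow> size H < size G"
  using size_member_le[of H "right_opts G"] by (cases G) simp

text \<open>\<open>G + H = {G\<^sup>L + H, G + H\<^sup>L | G\<^sup>R + H, G + H\<^sup>R}\<close>, as an identity of forms.\<close>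

function add_game :: "game \<Rightarrow> game \<Rightarrow> game" where
  "add_game G H =
     Game ((\<lambda>G'. add_game G' H) |`| left_opts G |\<union>| (\<lambda>H'. add_game G H') |`| left_opts H)
          ((\<lambda>G'. add_game G' H) |`| right_opts G |\<union>| (\<lambda>H'. add_game G H') |`| right_opts H)"
  by auto
termination
  by (relation "measure (\<lambda>(G, H). size G + size H)")
     (auto dest: size_left_option size_right_option)

declare add_game.simps [simp del]

instantiation game :: comm_monoid_add
begin

definition zero_game :: game where "0 = Game {||} {||}"

definition plus_game :: "game \<Rightarrow> game \<Rightarrow> game" where "G + H = add_game G H"

lemma left_opts_plus:
  "left_opts (G + H) =
     (\<lambda>G'. G' + H) |`| left_opts G |\<union>| (\<lambda>H'. G + H') |`| left_opts H" for G H :: game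
  unfolding plus_game_def by (subst add_game.simps) simp

lemma right_opts_plus:
  "right_opts (G + H) =
     (\<lambda>G'. G' + H) |`| right_opts G |\<union>| (\<lambda>H'. G + H') |`| right_opts H" for G H :: game
  unfolding plus_game_def by (subst add_game.simps) simp

instance
proof
  fix G H J :: game
  show "G + H + J = G + (H + J)"
  proof (induction "size G + size H + size J" arbitrary: G H J rule: less_induct)
    case less
    have "G' + H + J = G' + (H + J)" if "is_option G' G" for G'
      using less[of G' H J] that
      by (auto simp: is_option_def dest: size_left_option size_right_option)
    moreover have "G + H' + J = G + (H' + J)" if "is_option H' H" for H'
      using less[of G H' J] that
      by (auto simp: is_option_def dest: size_left_option size_right_option)
    moreover have "G + H + J' = G + (H + J')" if "is_option J' J" for J'
      using less[of G H J'] that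
      by (auto simp: is_option_def dest: size_left_option size_right_option)
    ultimately show ?case
      by (intro game.expand)
         (auto simp: left_opts_plus right_opts_plus fimage_funion fset.map_comp o_def
            is_option_def funion_assoc intro!: arg_cong2[where f = funion] fset.map_cong)
  qed
next
  fix G H :: game
  show "G + H = H + G"
  proof (induction "size G + size H" arbitrary: G H rule: less_induct)
    case less
    have "G' + H = H + G'" if "is_option G' G" for G'
      using less[of G' H] that
      by (auto simp: is_option_def dest: size_left_option size_right_option)
    moreover have "G + H' = H' + G" if "is_option H' H" for H'
      using less[of G H'] that
      by (auto simp: is_option_def dest: size_left_option size_right_option)
    ultimately show ?case
      by (intro game.expand)
         (auto simp: left_opts_plus right_opts_plus is_option_def
            funion_commute[of "_ |`| left_opts H"] funion_commute[of "_ |`| right_opts H"]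
            intro!: arg_cong2[where f = funion] fset.map_cong)
  qed
next
  fix G :: game
  show "0 + G = G"
  proof (induction "size G" arbitrary: G rule: less_induct)
    case less
    have "0 + G' = G'" if "is_option G' G" for G'
      using less[of G'] that
      by (auto simp: is_option_def dest: size_left_option size_right_option)
    then have "(\<lambda>G'. 0 + G') |`| left_opts G = id |`| left_opts G"
      "(\<lambda>G'. 0 + G') |`| right_opts G = id |`| right_opts G"
      by (auto intro!: fset.map_cong simp: is_option_def)
    then show ?case
      by (intro game.expand)
         (simp add: left_opts_plus right_opts_plus zero_game_def fset.map_id)
  qed
qed

end

datatype player = Left | Right

fun opponent :: "player \<Rightarrow> player" where
  "opponent Left = Right"
| "opponent Right = Left"

fun opts :: "player \<Rightarrow> game \<Rightarrow> game fset" where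
  "opts Left G = left_opts G"
| "opts Right G = right_opts G"

text \<open>
  \<open>wins_first p G\<close>: under misere play, player \<open>p\<close> wins \<open>G\<close> when moving first.
\<close>

function wins_first :: "player \<Rightarrow> game \<Rightarrow> bool" where
  "wins_first p G \<longleftrightarrow>
     opts p G = {||} \<or> (\<exists>H|\<in>|opts p G. \<not> wins_first (opponent p) H)"
  by auto
termination
proof (relation "measure (\<lambda>(p, G). size G)", goal_cases)
  case (2 p G H)
  then show ?case by (cases p) (auto dest: size_left_option size_right_option)
qed simp

declare wins_first.simps [simp del]

text \<open>
  The outcome classes, named after the player who wins under optimal play whoever starts:
  \<open>Next_wins\<close> (the first player) is \<open>\<N>\<close> and \<open>Previous_wins\<close> (the second player) is \<open>\<P>\<close>.
\<close>

datatype outcome = Left_wins | Right_wins | Next_wins | Previous_wins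

instantiation outcome :: order
begin

definition less_eq_outcome :: "outcome \<Rightarrow> outcome \<Rightarrow> bool" where
  "a \<le> b \<longleftrightarrow> a = b \<or> a = Right_wins \<or> b = Left_wins"

definition less_outcome :: "outcome \<Rightarrow> outcome \<Rightarrow> bool" where
  "a < b \<longleftrightarrow> a \<le> b \<and> a \<noteq> (b :: outcome)"

instance
  by standard (auto simp: less_eq_outcome_def less_outcome_def)

end

definition misere_outcome :: "game \<Rightarrow> outcome" where
  "misere_outcome G =
     (if wins_first Left G
      then (if wins_first Right G then Next_wins else Left_wins)
      else (if wins_first Right G then Right_wins else Previous_wins))"

text \<open>
  The order on games is only a preorder on forms: equality of games in the theory is
  \<open>G \<ge> H \<and> H \<ge> G\<close>, whereas HOL equality on \<^typ>\<open>game\<close> is identity of forms.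
\<close>

instantiation game :: preorder
begin

definition less_eq_game :: "game \<Rightarrow> game \<Rightarrow> bool" where
  "H \<le> G \<longleftrightarrow> (\<forall>X. misere_outcome (G + X) \<ge> misere_outcome (H + X))"

definition less_game :: "game \<Rightarrow> game \<Rightarrow> bool" where
  "H < G \<longleftrightarrow> H \<le> G \<and> \<not> G \<le> (H :: game)"

instance
  by standard (auto simp: less_eq_game_def less_game_def intro: order_trans)

end

definition left_dead_end :: "game \<Rightarrow> bool" where
  "left_dead_end G \<longleftrightarrow> (\<forall>H. subposition H G \<longrightarrow> left_opts H = {||})"

end

(*
  On Left dead ends, G \<ge> H holds iff every Right move of G can be answered by a Right move of H
  leading again to a pair in the relation, where G and H must also run out of moves
  simultaneously. To cancel J from G + J \<ge> H + J, follow a Right move from G to G': if the answer is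
  made in J, going to J1, then play J to J1 in G' + J as well, and repeat. As J is finite, some
  answer is eventually made in H, to H' say, at a moment when the same position of J is left on both
  sides, and G' \<ge> H' follows by induction. If G = 0, then H + J has a run to the end as short as the
  shortest one of J, so H = 0.
*)

theory Submission
  imports Defs
begin

section \<open>Left dead ends and misere outcomes\<close>

lemma left_dead_end_iff:
  "left_dead_end G \<longleftrightarrow>
     left_opts G = {||} \<and> (\<forall>G'. G' |\<in>| right_opts G \<longrightarrow> left_dead_end G')"
proof
  assume G: "left_dead_end G"
  have "left_dead_end G'" if "G' |\<in>| right_opts G" for G'
    using G that unfolding left_dead_end_def subposition_def
    by (meson is_option_def rtranclp.rtrancl_into_rtrancl)
  with G show "left_opts G = {||} \<and> (\<forall>G'. G' |\<in>| right_opts G \<longrightarrow> left_dead_end G')"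
    by (auto simp: left_dead_end_def subposition_def)
next
  assume G: "left_opts G = {||} \<and> (\<forall>G'. G' |\<in>| right_opts G \<longrightarrow> left_dead_end G')"
  show "left_dead_end G"
    unfolding left_dead_end_def
  proof (intro allI impI)
    fix H
    assume "subposition H G"
    then have "is_option\<^sup>*\<^sup>* H G"
      by (simp add: subposition_def)
    then show "left_opts H = {||}"
    \<comment> \<open>The chain is split at its last step, into \<open>G\<close>. As
      \<open>G\<close> has no Left option, that step comes from a Right option of
      \<open>G\<close>.\<close>
    proof (cases rule: rtranclp.cases)
      case rtrancl_refl
      with G show ?thesis by simp
    next
      case (rtrancl_into_rtrancl G')
      with G show ?thesis
        by (auto simp: is_option_def left_dead_end_def subposition_def)
    qed
  qed
qed

lemma left_opts_left_dead_end: "left_dead_end G \<Longrightarrow> left_opts G = {||}"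
  using left_dead_end_iff by blast

lemma left_dead_end_right_option:
  "left_dead_end G \<Longrightarrow> G' |\<in>| right_opts G \<Longrightarrow> left_dead_end G'"
  using left_dead_end_iff by blast

lemma left_dead_end_plus:
  "left_dead_end G \<Longrightarrow> left_dead_end H \<Longrightarrow> left_dead_end (G + H)"
proof (induction "size G + size H" arbitrary: G H rule: less_induct)
  case less
  have "left_dead_end (G' + H)" if "G' |\<in>| right_opts G" for G'
    using less that size_right_option[OF that] left_dead_end_iff[of G] by simp
  moreover have "left_dead_end (G + H')" if "H' |\<in>| right_opts H" for H'
    using less that size_right_option[OF that] left_dead_end_iff[of H] by simp
  ultimately show ?case
    using less.prems left_dead_end_iff[of G] left_dead_end_iff[of H]
    by (subst left_dead_end_iff) (auto simp: left_opts_plus right_opts_plus)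
qed

lemma wins_first_Left_iff:
  "wins_first Left G \<longleftrightarrow>
     left_opts G = {||} \<or> (\<exists>H. H |\<in>| left_opts G \<and> \<not> wins_first Right H)"
  by (subst wins_first.simps) auto

lemma wins_first_Right_iff:
  "wins_first Right G \<longleftrightarrow>
     right_opts G = {||} \<or> (\<exists>H. H |\<in>| right_opts G \<and> \<not> wins_first Left H)"
  by (subst wins_first.simps) auto

text \<open>The order on the four outcomes is a product of two two-element orders, one for each
  starting player.\<close>

lemma misere_outcome_le_iff:
  "misere_outcome H \<le> misere_outcome G \<longleftrightarrow>
     (wins_first Left H \<longrightarrow> wins_first Left G) \<and> (wins_first Right G \<longrightarrow> wins_first Right H)"
  by (auto simp: misere_outcome_def less_eq_outcome_def)

section \<open>Right simulation and its soundness\<close>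

inductive right_sim :: "game \<Rightarrow> game \<Rightarrow> bool" where
  right_simI:
    "\<lbrakk>right_opts G = {||} \<Longrightarrow> right_opts H = {||};
      \<And>G'. G' |\<in>| right_opts G \<Longrightarrow> \<exists>H'. H' |\<in>| right_opts H \<and> right_sim G' H'\<rbrakk>
     \<Longrightarrow> right_sim G H"

text \<open>This clause reflects misere play, where running out of moves wins. The converse follows
  from the step clause, as a move of \<open>G\<close> needs an answer in \<open>H\<close>.\<close>

lemma right_sim_stop: "right_sim G H \<Longrightarrow> right_opts G = {||} \<Longrightarrow> right_opts H = {||}"
  by (auto elim: right_sim.cases)

lemma right_sim_step:
  assumes "right_sim G H" "G' |\<in>| right_opts G"
  obtains H' where "H' |\<in>| right_opts H" "right_sim G' H'"
  using assms by (auto elim: right_sim.cases)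

text \<open>Right copies in \<open>H + X\<close> a winning strategy for \<open>G + X\<close>, using
  the simulation for moves in \<open>G\<close> and repeating moves in \<open>X\<close>. Left can
  move only in \<open>X\<close>, so her options on the two sides correspond.\<close>

lemma right_sim_imp_outcome_le:
  assumes "left_dead_end G" "left_dead_end H"
    and "right_sim G H"
  shows "misere_outcome (H + X) \<le> misere_outcome (G + X)"
  using assms
proof (induction "size G + size H + size X" arbitrary: G H X rule: less_induct)
  case less
  have IH_move: "misere_outcome (H' + X) \<le> misere_outcome (G' + X)"
    if "G' |\<in>| right_opts G" "H' |\<in>| right_opts H" "right_sim G' H'" for G' H'
    using that less.hyps[of G' H' X] size_right_option[OF that(1)] size_right_option[OF that(2)]
      left_dead_end_right_option[OF less.prems(1) that(1)]
      left_dead_end_right_option[OF less.prems(2) that(2)]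
    by simp
  have IH_other: "misere_outcome (H + X') \<le> misere_outcome (G + X')"
    if "X' |\<in>| left_opts X \<or> X' |\<in>| right_opts X" for X'
    using less that size_right_option[of X' X] size_left_option[of X' X] by auto
  have "wins_first Left (G + X)" if "wins_first Left (H + X)"
    using that IH_other wins_first_Left_iff[of "G + X"] wins_first_Left_iff[of "H + X"]
      left_opts_left_dead_end[OF less.prems(1)] left_opts_left_dead_end[OF less.prems(2)]
    by (auto simp: left_opts_plus misere_outcome_le_iff)
  moreover have "wins_first Right (H + X)" if win: "wins_first Right (G + X)"
  proof -
    consider (stop) "right_opts G = {||}" "right_opts X = {||}"
      | (move) G' where "G' |\<in>| right_opts G" "\<not> wins_first Left (G' + X)"
      | (other) X' where "X' |\<in>| right_opts X" "\<not> wins_first Left (G + X')"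
      using win wins_first_Right_iff[of "G + X"] by (auto simp: right_opts_plus)
    then show ?thesis
    proof cases
      case stop
      then show ?thesis
        using right_sim_stop[OF less.prems(3)] wins_first_Right_iff[of "H + X"]
        by (simp add: right_opts_plus)
    next
      case move
      obtain H' where H': "H' |\<in>| right_opts H" "right_sim G' H'"
        using right_sim_step[OF less.prems(3) move(1)] .
      then have "\<not> wins_first Left (H' + X)"
        using IH_move[OF move(1)] move(2) by (auto simp: misere_outcome_le_iff)
      with H' show ?thesis
        using wins_first_Right_iff[of "H + X"] by (auto simp: right_opts_plus)
    next
      case other
      then have "\<not> wins_first Left (H + X')"
        using IH_other[of X'] by (auto simp: misere_outcome_le_iff)
      with other show ?thesis
        using wins_first_Right_iff[of "H + X"] by (auto simp: right_opts_plus)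
    qed
  qed
  ultimately show ?case
    by (simp add: misere_outcome_le_iff)
qed

section \<open>Distinguishing games\<close>

lemma ex_wins_first_Right_plus: "left_dead_end G \<Longrightarrow> \<exists>X. wins_first Right (G + X)"
proof (induction "size G" arbitrary: G rule: less_induct)
  case less
  show ?case
  proof (cases "right_opts G = {||}")
    case True
    then have "wins_first Right (G + 0)"
      using wins_first_Right_iff[of G] by simp
    then show ?thesis ..
  next
    case False
    then obtain G' where G': "G' |\<in>| right_opts G" by auto
    then have dead: "left_dead_end G'"
      using less.prems left_dead_end_right_option by blast
    then obtain X where X: "wins_first Right (G' + X)"
      using less.hyps size_right_option[OF G'] by blast
    \<comment> \<open>Left has exactly one move here, to \<open>G' + X\<close>, which Right wins
      moving first.\<close>
    have "\<not> wins_first Left (G' + Game {|X|} {||})"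
      using X dead wins_first_Left_iff[of "G' + Game {|X|} {||}"] left_opts_left_dead_end[of G']
      by (simp add: left_opts_plus)
    then have "wins_first Right (G + Game {|X|} {||})"
      using G' wins_first_Right_iff[of "G + Game {|X|} {||}"] by (auto simp: right_opts_plus)
    then show ?thesis ..
  qed
qed

lemma wins_first_Left_if_left_dead_end: "left_dead_end G \<Longrightarrow> wins_first Left G"
  by (simp add: wins_first_Left_iff left_opts_left_dead_end)

text \<open>If no \<open>H'\<close> answers \<open>G'\<close>, induction gives for each
  \<open>H'\<close> a game separating it from \<open>G'\<close>. Offering all of these to Left lets
  her refute every move to \<open>H'\<close>, while each of them loses for her after the move to
  \<open>G'\<close>.\<close>

lemma ex_distinguishing_game:
  assumes "left_dead_end G" "left_dead_end H" "\<not> right_sim G H"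
  shows "\<exists>X. wins_first Right (G + X) \<and> \<not> wins_first Right (H + X)"
  using assms
proof (induction "size G" arbitrary: G H rule: less_induct)
  case less
  consider (stop) "right_opts G = {||}" "right_opts H \<noteq> {||}"
    | (move) G' where "G' |\<in>| right_opts G" "\<And>H'. H' |\<in>| right_opts H \<Longrightarrow> \<not> right_sim G' H'"
    using less.prems(3) right_simI by blast
  then show ?case
  proof cases
    case stop
    \<comment> \<open>Right must move, and then Left has no move and wins.\<close>
    have "\<not> wins_first Right H"
      using stop less.prems(2) wins_first_Right_iff[of H] wins_first_Left_if_left_dead_end
        left_dead_end_right_option by blast
    then have "wins_first Right (G + 0) \<and> \<not> wins_first Right (H + 0)"
      using stop wins_first_Right_iff[of G] by simp
    then show ?thesis ..
  next
    case move
    then have dead: "left_dead_end G'"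
      using less.prems left_dead_end_right_option by blast
    have "\<exists>X. wins_first Right (G' + X) \<and> \<not> wins_first Right (H' + X)"
      if "H' |\<in>| right_opts H" for H'
      using less.hyps[OF size_right_option[OF move(1)] dead] move(2) that less.prems(2)
        left_dead_end_right_option by blast
    then obtain f where f: "wins_first Right (G' + f H')" "\<not> wins_first Right (H' + f H')"
      if "H' |\<in>| right_opts H" for H'
      by metis
    obtain Y where Y: "wins_first Right (G' + Y)"
      using ex_wins_first_Right_plus[OF dead] by blast
    \<comment> \<open>\<open>Y\<close> keeps Left from winning \<open>G' + X\<close> for want of a move when \<open>H\<close> has no options, and the
        Right option \<open>0\<close> keeps Right from winning \<open>H + X\<close> in the same way.\<close>
    define X where "X = Game (finsert Y (f |`| right_opts H)) {|0|}"
    have "\<not> wins_first Left (G' + X)"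
      using f(1) Y dead wins_first_Left_iff[of "G' + X"] left_opts_left_dead_end[of G']
      by (auto simp: left_opts_plus X_def)
    then have "wins_first Right (G + X)"
      using move(1) wins_first_Right_iff[of "G + X"] by (auto simp: right_opts_plus)
    moreover have "wins_first Left (H' + X)" if "H' |\<in>| right_opts H" for H'
      using f(2)[OF that] that wins_first_Left_iff[of "H' + X"]
      by (auto simp: left_opts_plus X_def)
    then have "\<not> wins_first Right (H + X)"
      using wins_first_Right_iff[of "H + X"] wins_first_Left_if_left_dead_end[OF less.prems(2)]
      by (auto simp: right_opts_plus X_def)
    ultimately show ?thesis by blast
  qed
qed

theorem left_dead_end_le_iff_right_sim:
  assumes "left_dead_end G" "left_dead_end H"
  shows "H \<le> G \<longleftrightarrow> right_sim G H"
proof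
  assume "H \<le> G"
  then show "right_sim G H"
    using ex_distinguishing_game[OF assms] by (auto simp: less_eq_game_def misere_outcome_le_iff)
next
  assume "right_sim G H"
  then show "H \<le> G"
    using right_sim_imp_outcome_le[OF assms] by (simp add: less_eq_game_def)
qed

section \<open>Lengths of Right runs, and the case where \<open>G\<close> has no Right
  options\<close>

inductive right_run :: "game \<Rightarrow> nat \<Rightarrow> bool" where
  right_run_stop: "right_opts G = {||} \<Longrightarrow> right_run G 0"
| right_run_step: "G' |\<in>| right_opts G \<Longrightarrow> right_run G' n \<Longrightarrow> right_run G (Suc n)"

lemma ex_right_run: "\<exists>n. right_run G n"
proof (induction "size G" arbitrary: G rule: less_induct)
  case less
  show ?case
  proof (cases "right_opts G = {||}")
    case True
    then show ?thesis
      using right_run_stop by blast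
  next
    case False
    then obtain G' where "G' |\<in>| right_opts G" by auto
    then show ?thesis
      using less size_right_option right_run_step by blast
  qed
qed

lemma right_run_sim: "right_run G n \<Longrightarrow> right_sim G H \<Longrightarrow> right_run H n"
proof (induction arbitrary: H rule: right_run.induct)
  case (right_run_stop G)
  then show ?case
    using right_sim_stop right_run.right_run_stop by blast
next
  case (right_run_step G' G n)
  obtain H' where "H' |\<in>| right_opts H" "right_sim G' H'"
    using right_sim_step[OF right_run_step.prems right_run_step.hyps(1)] .
  then show ?case
    using right_run_step.IH right_run.right_run_step by blast
qed

text \<open>A run of a sum interleaves complete runs of its summands.\<close>

lemma right_run_plusE:
  assumes "right_run (G + H) n"
  obtains a b where "right_run G a" "right_run H b" "n = a + b"
proof -
  have "\<exists>a b. right_run G a \<and> right_run H b \<and> n = a + b"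
    using assms
  proof (induction "G + H" n arbitrary: G H rule: right_run.induct)
    case right_run_stop
    then show ?case
      by (auto simp: right_opts_plus intro: right_run.right_run_stop)
  next
    case (right_run_step K n)
    then consider G' where "G' |\<in>| right_opts G" "K = G' + H"
      | H' where "H' |\<in>| right_opts H" "K = G + H'"
      by (auto simp: right_opts_plus)
    then show ?case
    proof cases
      case 1
      then show ?thesis
        using right_run_step.hyps(3) by (metis add_Suc right_run.right_run_step)
    next
      case 2
      then show ?thesis
        using right_run_step.hyps(3) by (metis add_Suc_right right_run.right_run_step)
    qed
  qed
  then show thesis using that by blast
qed

lemma right_sim_absorb:
  assumes "right_sim J (H + J)"
  shows "right_opts H = {||}"
proof -
  define n where "n = (LEAST n. right_run J n)"
  have "right_run J n"
    unfolding n_def using ex_right_run by (rule LeastI_ex)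
  then have "right_run (H + J) n"
    using assms by (rule right_run_sim)
  then obtain a b where ab: "right_run H a" "right_run J b" "n = a + b"
    by (rule right_run_plusE)
  have "n \<le> b"
    unfolding n_def using ab(2) by (rule Least_le)
  \<comment> \<open>Minimality of \<open>n\<close> leaves no length for the share \<open>a\<close>
    of \<open>H\<close> in the run.\<close>
  then have "right_run H 0"
    using ab by simp
  then show ?thesis
    by cases simp
qed

text \<open>The simulation sees only Right options, so such a \<open>G\<close> acts as zero in the
  sum.\<close>

lemma right_opts_empty_right_sim_plus:
  assumes "right_opts G = {||}" "right_sim (G + J) K"
  shows "right_sim J K"
  using assms(2)
proof (induction "size J" arbitrary: J K rule: less_induct)
  case less
  show ?case
  proof (rule right_simI)
    assume "right_opts J = {||}"
    then show "right_opts K = {||}"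
      using right_sim_stop[OF less.prems] assms(1) by (simp add: right_opts_plus)
  next
    fix J'
    assume J': "J' |\<in>| right_opts J"
    then obtain K' where "K' |\<in>| right_opts K" "right_sim (G + J') K'"
      using right_sim_step[OF less.prems, of "G + J'"] by (auto simp: right_opts_plus)
    then show "\<exists>K'. K' |\<in>| right_opts K \<and> right_sim J' K'"
      using less.hyps size_right_option[OF J'] by blast
  qed
qed

section \<open>Cancellation\<close>

theorem right_sim_cancel: "right_sim (G + J) (H + J) \<Longrightarrow> right_sim G H"
proof (induction "size G + size H + size J" arbitrary: G H J rule: less_induct)
  case less
  show ?case
  proof (rule right_simI)
    assume "right_opts G = {||}"
    then show "right_opts H = {||}"
      using right_opts_empty_right_sim_plus[OF _ less.prems] right_sim_absorb[of J H] by simp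
  next
    fix G'
    assume G': "G' |\<in>| right_opts G"
    \<comment> \<open>\<open>K\<close> is whatever position of \<open>J\<close> remains when
      \<open>H\<close> answers. The measure drops because \<open>G'\<close> and \<open>H'\<close>
      are smaller than \<open>G\<close> and \<open>H\<close>.\<close>
    have cancel: "right_sim G' H'"
      if "right_sim (G' + K) (H' + K)" "H' |\<in>| right_opts H" "size K \<le> size J" for H' K
      using less.hyps[of G' H' K] that size_right_option[OF G'] size_right_option[OF that(2)]
      by simp
    \<comment> \<open>\<open>H\<close> has not yet answered the move to \<open>G'\<close>, so its copy \<open>K'\<close> of the summand is one
        move ahead of \<open>K\<close>.\<close>
    have ahead: "\<exists>H'. H' |\<in>| right_opts H \<and> right_sim G' H'"
      if "right_sim (G' + K) (H + K')" "K' |\<in>| right_opts K" "size K \<le> size J" for K K'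
      using that
    proof (induction "size K" arbitrary: K K' rule: less_induct)
      case (less K K')
      \<comment> \<open>The left copy catches up by moving to \<open>K'\<close>. An answer in
        \<open>H\<close> leaves equal summands, ready for \<open>cancel\<close>; an answer
        \<open>K''\<close> restores the one-move lead with \<open>K'\<close> in place of
        \<open>K\<close>.\<close>
      have "G' + K' |\<in>| right_opts (G' + K)"
        using less.prems(2) by (simp add: right_opts_plus)
      then obtain M where M: "M |\<in>| right_opts (H + K')" "right_sim (G' + K') M"
        using right_sim_step[OF less.prems(1)] by blast
      then consider H' where "H' |\<in>| right_opts H" "M = H' + K'"
        | K'' where "K'' |\<in>| right_opts K'" "M = H + K''"
        by (auto simp: right_opts_plus)
      then show ?case
      proof cases
        case 1
        then show ?thesis
          using M(2) cancel[of K' H'] less.prems(3) size_right_option[OF less.prems(2)] by auto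
      next
        case 2
        then show ?thesis
          using M(2) less.hyps[of K' K''] less.prems(3) size_right_option[OF less.prems(2)] by simp
      qed
    qed
    have "G' + J |\<in>| right_opts (G + J)"
      using G' by (simp add: right_opts_plus)
    then obtain M where M: "M |\<in>| right_opts (H + J)" "right_sim (G' + J) M"
      using right_sim_step[OF less.prems] by blast
    then consider H' where "H' |\<in>| right_opts H" "M = H' + J"
      | J' where "J' |\<in>| right_opts J" "M = H + J'"
      by (auto simp: right_opts_plus)
    then show "\<exists>H'. H' |\<in>| right_opts H \<and> right_sim G' H'"
    proof cases
      case 1
      then show ?thesis
        using M(2) cancel[of J H'] by auto
    next
      case 2
      then show ?thesis
        using M(2) ahead[of J J'] by simp
    qed
  qed
qed

theorem mainTheorem2:
  fixes G H J :: game
  assumes "left_dead_end G" and "left_dead_end H" and "left_dead_end J"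
    and "G + J \<ge> H + J"
  shows "G \<ge> H"
  using assms right_sim_cancel[of G J H]
  by (simp add: left_dead_end_le_iff_right_sim left_dead_end_plus)

end
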